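(* Let $H$ and $Y$ be Hilbert spaces, let $(T(t))_{t\ge 0}$ be a bounded $C_0$-semigroup on $H$ with infinitesimal generator $A$, and let $C\in\mathcal{L}(D(A),Y)$ be an infinite-time admissible observation operator for $(T(t))_{t\ge0}$. Then conditions (B1) and (B2) (as defined in the context) are equivalent.
   Context: $\mathcal{L}(D(A),Y)$ denotes the operators $D(A)\to Y$ that are bounded with respect to the graph norm on $D(A)$; $\mathbb{C}_+=\{s\in\mathbb{C}:\operatorname{Re}s>0\}$. $C\in\mathcal{L}(D(A),Y)$ is a finite-time admissible observation operator for $(T(t))_{t\ge0}$ if for each $\eta>0$ there is a constant $K_\eta>0$ with $$\int_0^\eta\|CT(t)x\|^2\,dt\le K_\eta^2\|x\|^2\qquad (x\in D(A)).$$ It is infinite-time admissible if in addition the constants $K_\eta$ can be taken uniformly bounded in $\eta$. Condition (B1): for each $r>0$ there exists a constant $m_r>0$ such that the $m_r$ are uniformly bounded, $m_r\to0$ as $r\to\infty$, and $$\|C(sI-A)^{-1}x\|\le\frac{m_{\operatorname{Re}s}\|x\|}{\sqrt{\operatorname{Re}s}}\qquad(x\in H,\ s\in\mathbb{C}_+).$$ Condition (B2a): for each $\tau>0$ there exists a constant $K_\tau>0$ such that the $K_\tau$ are uniformly bounded, $K_\tau\to0$ as $\tau\to0$, and $$\Big\|\tau^{-1/2}\int_0^\tau e^{i\omega t}CT(t)x\,dt\Big\|\le K_\tau\|x\|\qquad(x\in D(A),\ \omega\in\mathbb{R}).$$ Condition (B2b): the same as (B2a) with $\int_0^\tau$ replaced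 by $\int_\tau^{2\tau}$. Conditions (B2a) and (B2b) are equivalent to each other, and (B2) refers to either of them. *)

theory Defs
  imports "HOL-Analysis.Analysis"
begin

text \<open>
  Complex Hilbert spaces. The underlying real structure is the library's \<open>real_inner\<close>, whose
  inner product is the real part of the complex one; positivity, the norm and the topology are
  inherited from there.
\<close>

class complex_inner = real_inner +
  fixes scaleC :: "complex \<Rightarrow> 'a \<Rightarrow> 'a" (infixr \<open>*\<^sub>C\<close> 75)
    and cinner :: "'a \<Rightarrow> 'a \<Rightarrow> complex"
  assumes scaleC_add_right: "c *\<^sub>C (x + y) = c *\<^sub>C x + c *\<^sub>C y"
    and scaleC_add_left: "(c + d) *\<^sub>C x = c *\<^sub>C x + d *\<^sub>C x"
    and scaleC_scaleC: "c *\<^sub>C d *\<^sub>C x = (c * d) *\<^sub>C x"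
    and scaleC_of_real: "complex_of_real r *\<^sub>C x = r *\<^sub>R x"
    and cinner_commute: "cinner x y = cnj (cinner y x)"
    and cinner_add_left: "cinner (x + y) z = cinner x z + cinner y z"
    and cinner_scaleC_left: "cinner (c *\<^sub>C x) y = c * cinner x y"
    and inner_eq_Re_cinner: "x \<bullet> y = Re (cinner x y)"

class complex_hilbert_space = complex_inner + complete_space

instantiation complex :: complex_hilbert_space
begin

definition scaleC_complex :: "complex \<Rightarrow> complex \<Rightarrow> complex"
  where "scaleC_complex c x = c * x"

definition cinner_complex :: "complex \<Rightarrow> complex \<Rightarrow> complex"
  where "cinner_complex x y = x * cnj y"

instance
  by standard
    (auto simp: scaleC_complex_def cinner_complex_def algebra_simps inner_complex_def scaleR_conv_of_real)

end

definition bounded_clinear :: "('a::complex_inner \<Rightarrow> 'b::complex_inner) \<Rightarrow> bool"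
  where "bounded_clinear f \<longleftrightarrow> bounded_linear f \<and> (\<forall>c x. f (c *\<^sub>C x) = c *\<^sub>C f x)"

text \<open>Only the values \<open>T t\<close> with \<open>t \<ge> 0\<close> are meaningful.\<close>

definition C0_semigroup :: "(real \<Rightarrow> 'a::complex_inner \<Rightarrow> 'a) \<Rightarrow> bool"
  where "C0_semigroup T \<longleftrightarrow>
    (\<forall>t\<ge>0. bounded_clinear (T t)) \<and>
    (\<forall>x. T 0 x = x) \<and>
    (\<forall>s\<ge>0. \<forall>t\<ge>0. \<forall>x. T (s + t) x = T s (T t x)) \<and>
    (\<forall>x. ((\<lambda>t. T t x) \<longlongrightarrow> x) (at_right 0))"

definition bounded_semigroup :: "(real \<Rightarrow> 'a::complex_inner \<Rightarrow> 'a) \<Rightarrow> bool"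
  where "bounded_semigroup T \<longleftrightarrow> (\<exists>M. \<forall>t\<ge>0. \<forall>x. norm (T t x) \<le> M * norm x)"

definition gen_dom :: "(real \<Rightarrow> 'a::complex_inner \<Rightarrow> 'a) \<Rightarrow> 'a set"
  where "gen_dom T = {x. \<exists>y. ((\<lambda>t. (1 / t) *\<^sub>R (T t x - x)) \<longlongrightarrow> y) (at_right 0)}"

text \<open>Only meaningful on \<open>gen_dom T\<close>.\<close>

definition gen :: "(real \<Rightarrow> 'a::complex_inner \<Rightarrow> 'a) \<Rightarrow> 'a \<Rightarrow> 'a"
  where "gen T x = Lim (at_right 0) (\<lambda>t. (1 / t) *\<^sub>R (T t x - x))"

text \<open>
  The inverse of \<open>sI - A\<close> as a map from \<open>D(A)\<close> to the whole space. It exists as a bounded operator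
  for all \<open>s\<close> in the open right half-plane when the semigroup is bounded (Hille--Yosida).
\<close>

definition resolvent :: "(real \<Rightarrow> 'a::complex_inner \<Rightarrow> 'a) \<Rightarrow> complex \<Rightarrow> 'a \<Rightarrow> 'a"
  where "resolvent T s = the_inv_into (gen_dom T) (\<lambda>y. s *\<^sub>C y - gen T y)"

definition graph_norm :: "(real \<Rightarrow> 'a::complex_inner \<Rightarrow> 'a) \<Rightarrow> 'a \<Rightarrow> real"
  where "graph_norm T x = norm x + norm (gen T x)"

text \<open>
  Membership in \<open>L(D(A), Y)\<close>. The partial operator is a total function whose values outside
  \<open>gen_dom T\<close> are unconstrained and never used.
\<close>

definition observation_operator ::
    "(real \<Rightarrow> 'a::complex_inner \<Rightarrow> 'a) \<Rightarrow> ('a \<Rightarrow> 'b::complex_inner) \<Rightarrow> bool"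
  where "observation_operator T C \<longleftrightarrow>
    (\<forall>x\<in>gen_dom T. \<forall>y\<in>gen_dom T. C (x + y) = C x + C y) \<and>
    (\<forall>c. \<forall>x\<in>gen_dom T. C (c *\<^sub>C x) = c *\<^sub>C C x) \<and>
    (\<exists>M. \<forall>x\<in>gen_dom T. norm (C x) \<le> M * graph_norm T x)"

text \<open>
  For \<open>x \<in> D(A)\<close> the map \<open>t \<mapsto> C (T t x)\<close> is continuous on \<open>[0,\<infinity>)\<close>, so the gauge integrals below
  are Riemann integrals of continuous functions; no separability of \<open>Y\<close> is needed.
\<close>

definition admissible_with ::
    "(real \<Rightarrow> real) \<Rightarrow> (real \<Rightarrow> 'a::complex_inner \<Rightarrow> 'a) \<Rightarrow> ('a \<Rightarrow> 'b::complex_inner) \<Rightarrow> bool"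
  where "admissible_with K T C \<longleftrightarrow>
    (\<forall>\<eta>>0. K \<eta> > 0 \<and>
      (\<forall>x\<in>gen_dom T. integral {0..\<eta>} (\<lambda>t. (norm (C (T t x)))\<^sup>2) \<le> (K \<eta>)\<^sup>2 * (norm x)\<^sup>2))"

definition finite_time_admissible ::
    "(real \<Rightarrow> 'a::complex_inner \<Rightarrow> 'a) \<Rightarrow> ('a \<Rightarrow> 'b::complex_inner) \<Rightarrow> bool"
  where "finite_time_admissible T C \<longleftrightarrow> observation_operator T C \<and> (\<exists>K. admissible_with K T C)"

definition infinite_time_admissible ::
    "(real \<Rightarrow> 'a::complex_inner \<Rightarrow> 'a) \<Rightarrow> ('a \<Rightarrow> 'b::complex_inner) \<Rightarrow> bool"
  where "infinite_time_admissible T C \<longleftrightarrow>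
    observation_operator T C \<and> (\<exists>K. admissible_with K T C \<and> bounded (K ` {0<..}))"

definition cond_B1 ::
    "(real \<Rightarrow> 'a::complex_inner \<Rightarrow> 'a) \<Rightarrow> ('a \<Rightarrow> 'b::complex_inner) \<Rightarrow> bool"
  where "cond_B1 T C \<longleftrightarrow>
    (\<exists>m::real \<Rightarrow> real. (\<forall>r>0. m r > 0) \<and> bounded (m ` {0<..}) \<and> (m \<longlongrightarrow> 0) at_top \<and>
      (\<forall>x s. Re s > 0 \<longrightarrow> norm (C (resolvent T s x)) \<le> m (Re s) * norm x / sqrt (Re s)))"

definition cond_B2a ::
    "(real \<Rightarrow> 'a::complex_inner \<Rightarrow> 'a) \<Rightarrow> ('a \<Rightarrow> 'b::complex_inner) \<Rightarrow> bool"
  where "cond_B2a T C \<longleftrightarrow>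
    (\<exists>K::real \<Rightarrow> real. (\<forall>\<tau>>0. K \<tau> > 0) \<and> bounded (K ` {0<..}) \<and> (K \<longlongrightarrow> 0) (at_right 0) \<and>
      (\<forall>\<tau>>0. \<forall>x\<in>gen_dom T. \<forall>\<omega>::real.
        norm (\<tau> powr (- 1 / 2) *\<^sub>R
          integral {0..\<tau>} (\<lambda>t. exp (\<i> * of_real (\<omega> * t)) *\<^sub>C C (T t x))) \<le> K \<tau> * norm x))"

definition cond_B2b ::
    "(real \<Rightarrow> 'a::complex_inner \<Rightarrow> 'a) \<Rightarrow> ('a \<Rightarrow> 'b::complex_inner) \<Rightarrow> bool"
  where "cond_B2b T C \<longleftrightarrow>
    (\<exists>K::real \<Rightarrow> real. (\<forall>\<tau>>0. K \<tau> > 0) \<and> bounded (K ` {0<..}) \<and> (K \<longlongrightarrow> 0) (at_right 0) \<and>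
      (\<forall>\<tau>>0. \<forall>x\<in>gen_dom T. \<forall>\<omega>::real.
        norm (\<tau> powr (- 1 / 2) *\<^sub>R
          integral {\<tau>..2 * \<tau>} (\<lambda>t. exp (\<i> * of_real (\<omega> * t)) *\<^sub>C C (T t x))) \<le> K \<tau> * norm x))"

end

theory Submission
  imports Defs
begin

text \<open>
  Write \<open>R(s) = (s - A)\<^sup>-\<^sup>1\<close> and \<open>S(t) = e\<^sup>-\<^sup>a\<^sup>t T(t)\<close>, a semigroup with generator \<open>A - a\<close>, bounded by
  the same constant \<open>M \<ge> 1\<close> as \<open>T\<close> when \<open>Re a \<ge> 0\<close>. For \<open>p = \<integral>\<^sub>0\<^sup>\<tau> S(t) x dt\<close> the
  identity \<open>(A - a) p = S(\<tau>) x - x\<close> gives \<open>p = R(s) ((s - a) p + x - S(\<tau>) x)\<close>. Since \<open>C R(s)\<close> is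
  a bounded operator, \<open>C p = \<integral>\<^sub>0\<^sup>\<tau> e\<^sup>-\<^sup>a\<^sup>t C T(t) x dt\<close> for \<open>x \<in> D(A)\<close>. The equivalence of (B1) and
  (B2a) rests on these two facts.

  (B1) implies (B2a): take \<open>a = -i\<omega>\<close> and \<open>s = 1/\<tau> - i\<omega>\<close>. The argument of \<open>R(s)\<close> is
  \<open>p/\<tau> + x - S(\<tau>) x\<close>, of norm at most \<open>(2M + 1) \<parallel>x\<parallel>\<close>, so \<open>K\<^sub>\<tau> = (2M + 1) m\<^bsub>1/\<tau>\<^esub>\<close> works
  (\<open>output_integral_le_resolvent\<close>).

  (B2a) implies (B1): take \<open>a = s\<close>, so that \<open>C R(s) x = C p + C R(s) S(\<tau>) x\<close>. With
  \<open>\<tau> = ln (2M) / Re s\<close> the operator \<open>S(\<tau>)\<close> has norm at most \<open>1/2\<close>, and the last term is absorbed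
  into the left-hand side; \<open>C p\<close> is estimated through (B2a) after an integration by parts that removes
  the weight \<open>e\<^bsup>-t Re s\<^esup>\<close> (\<open>resolvent_le_output_integral\<close>).

  (B2a) implies (B2b) because the output on \<open>[\<tau>, 2\<tau>]\<close> is the output on \<open>[0, \<tau>]\<close> for the initial state
  \<open>T(\<tau>) x\<close>; the converse is a dyadic decomposition of \<open>(0, \<tau>]\<close> (\<open>output_integral_dyadic\<close>).
\<close>

section \<open>Scalar multiplication in complex inner product spaces\<close>

instance complex_hilbert_space \<subseteq> banach ..

lemma norm_scaleC: "norm (c *\<^sub>C (x::'a::complex_inner)) = cmod c * norm x"
proof -
  have real: "Im (cinner y y) = 0" for y :: 'a
    using arg_cong[OF cinner_commute[of y y], of Im] by simp
  have "cinner (c *\<^sub>C x) (c *\<^sub>C x) = c * cnj (c * cinner x x)"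
    by (metis cinner_commute cinner_scaleC_left)
  also have "\<dots> = complex_of_real ((cmod c)\<^sup>2) * cnj (cinner x x)"
    by (simp only: complex_norm_square) (simp add: algebra_simps)
  finally have "Re (cinner (c *\<^sub>C x) (c *\<^sub>C x)) = (cmod c)\<^sup>2 * Re (cinner x x)"
    by simp
  then have "(norm (c *\<^sub>C x))\<^sup>2 = (cmod c * norm x)\<^sup>2"
    by (simp add: power2_norm_eq_inner inner_eq_Re_cinner power_mult_distrib)
  then show ?thesis
    by (simp add: power2_eq_iff_nonneg)
qed

lemma bounded_bilinear_scaleC:
  "bounded_bilinear (\<lambda>c (x::'a::complex_inner). c *\<^sub>C x)"
proof
  fix r :: real and c :: complex and x :: 'a
  show "(r *\<^sub>R c) *\<^sub>C x = r *\<^sub>R c *\<^sub>C x"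
    by (simp add: scaleC_of_real[symmetric] scaleC_scaleC scaleR_conv_of_real scaleC_complex_def)
  show "c *\<^sub>C r *\<^sub>R x = r *\<^sub>R c *\<^sub>C x"
    by (simp only: scaleC_of_real[symmetric] scaleC_scaleC mult.commute)
next
  show "\<exists>K. \<forall>c (x::'a). norm (c *\<^sub>C x) \<le> norm c * norm x * K"
    by (rule exI[of _ 1]) (simp add: norm_scaleC)
qed (simp_all add: scaleC_add_left scaleC_add_right)

lemmas bounded_linear_scaleC_right =
  bounded_bilinear.bounded_linear_right[OF bounded_bilinear_scaleC]
lemmas scaleC_simps =
  bounded_bilinear.zero_left[OF bounded_bilinear_scaleC]
  bounded_bilinear.diff_left[OF bounded_bilinear_scaleC]
  bounded_bilinear.diff_right[OF bounded_bilinear_scaleC]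
  bounded_bilinear.minus_left[OF bounded_bilinear_scaleC]
  bounded_bilinear.minus_right[OF bounded_bilinear_scaleC]
  scaleC_add_left scaleC_add_right
lemmas tendsto_scaleC = bounded_bilinear.tendsto[OF bounded_bilinear_scaleC]

lemma scaleC_one: "1 *\<^sub>C x = (x::'a::complex_inner)"
  using scaleC_of_real[of 1 x] by simp

lemma scaleC_scaleR: "c *\<^sub>C r *\<^sub>R x = r *\<^sub>R c *\<^sub>C (x::'a::complex_inner)"
  by (rule bounded_bilinear.scaleR_right[OF bounded_bilinear_scaleC])

section \<open>Generators and rescaled semigroups\<close>

text \<open>\<open>has_gen T x y\<close> says that \<open>x \<in> D(A)\<close> and \<open>A x = y\<close>.\<close>

definition has_gen :: "(real \<Rightarrow> 'a::complex_inner \<Rightarrow> 'a) \<Rightarrow> 'a \<Rightarrow> 'a \<Rightarrow> bool"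
  where "has_gen T x y \<longleftrightarrow> ((\<lambda>t. (1 / t) *\<^sub>R (T t x - x)) \<longlongrightarrow> y) (at_right 0)"

lemma gen_dom_iff: "x \<in> gen_dom T \<longleftrightarrow> (\<exists>y. has_gen T x y)"
  by (simp add: gen_dom_def has_gen_def)

lemma has_gen_imp: "has_gen T x y \<Longrightarrow> x \<in> gen_dom T \<and> gen T x = y"
  by (auto simp: gen_dom_iff gen_def has_gen_def intro!: tendsto_Lim)

lemma has_gen_gen: "x \<in> gen_dom T \<Longrightarrow> has_gen T x (gen T x)"
  using has_gen_imp gen_dom_iff by metis

text \<open>The semigroup \<open>e\<^sup>-\<^sup>s\<^sup>t T(t)\<close>, whose generator is \<open>A - s\<close>.\<close>

definition rescale :: "complex \<Rightarrow> (real \<Rightarrow> 'a::complex_inner \<Rightarrow> 'a) \<Rightarrow> real \<Rightarrow> 'a \<Rightarrow> 'a"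
  where "rescale s T t x = exp (- (s * of_real t)) *\<^sub>C T t x"

lemma rescale_rescale: "rescale (- s) (rescale s T) = T"
  by (intro ext) (simp add: rescale_def scaleC_scaleC exp_add[symmetric] scaleC_one)

lemma has_gen_rescale:
  assumes "has_gen T x y"
  shows "has_gen (rescale s T) x (y - s *\<^sub>C x)"
proof -
  have e0: "((\<lambda>t::real. exp (- (s * of_real t))) \<longlongrightarrow> 1) (at_right 0)"
    by (auto intro!: tendsto_eq_intros)
  have "((\<lambda>w. exp (- (s * w))) has_field_derivative - s) (at 0)"
    by (auto intro!: derivative_eq_intros)
  then have "((\<lambda>w. (exp (- (s * w)) - 1) / w) \<longlongrightarrow> - s) (at 0)"
    by (simp add: has_field_derivative_iff)
  moreover have "filterlim complex_of_real (at 0) (at_right 0)"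
    by (auto simp: filterlim_at eventually_at_filter intro!: tendsto_eq_intros)
  ultimately have "((\<lambda>t::real. (exp (- (s * of_real t)) - 1) / of_real t) \<longlongrightarrow> - s) (at_right 0)"
    by (rule filterlim_compose)
  then have e1: "((\<lambda>t. (1/t) *\<^sub>R (exp (- (s * of_real t)) - 1)) \<longlongrightarrow> - s) (at_right 0)"
    by (simp add: scaleR_conv_of_real)
  have "((\<lambda>t. exp (- (s * of_real t)) *\<^sub>C ((1 / t) *\<^sub>R (T t x - x))
      + ((1/t) *\<^sub>R (exp (- (s * of_real t)) - 1)) *\<^sub>C x) \<longlongrightarrow> 1 *\<^sub>C y + (- s) *\<^sub>C x) (at_right 0)"
    using assms unfolding has_gen_def
    by (intro tendsto_add tendsto_scaleC e0 e1 tendsto_const)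
  moreover have "exp (- (s * of_real t)) *\<^sub>C ((1 / t) *\<^sub>R (T t x - x))
      + ((1/t) *\<^sub>R (exp (- (s * of_real t)) - 1)) *\<^sub>C x
      = (1 / t) *\<^sub>R (rescale s T t x - x)" for t
    by (simp only: scaleC_scaleR bounded_bilinear.scaleR_left[OF bounded_bilinear_scaleC]
        scaleR_add_right[symmetric] rescale_def)
      (simp add: scaleC_simps scaleC_one)
  ultimately show ?thesis
    unfolding has_gen_def by (simp add: scaleC_simps scaleC_one)
qed

lemma has_gen_rescale_iff: "has_gen (rescale s T) x y \<longleftrightarrow> has_gen T x (y + s *\<^sub>C x)"
proof
  assume "has_gen (rescale s T) x y"
  from has_gen_rescale[OF this, of "- s"] show "has_gen T x (y + s *\<^sub>C x)"
    by (simp add: rescale_rescale scaleC_simps)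
qed (auto dest: has_gen_rescale[where s = s])

text \<open>A bounded \<open>C\<^sub>0\<close>-semigroup together with a uniform bound \<open>M\<close>. The normalisation \<open>M \<ge> 1\<close> costs
  nothing and makes \<open>ln (2M)\<close> positive.\<close>

locale bounded_C0 =
  fixes T :: "real \<Rightarrow> 'h::complex_hilbert_space \<Rightarrow> 'h" and M :: real
  assumes C0: "C0_semigroup T"
    and bound: "\<And>t x. 0 \<le> t \<Longrightarrow> norm (T t x) \<le> M * norm x"
    and M_ge_1: "1 \<le> M"
begin

lemma T_clinear: "0 \<le> t \<Longrightarrow> bounded_clinear (T t)"
  and T_0: "T 0 x = x"
  and T_add: "0 \<le> s \<Longrightarrow> 0 \<le> t \<Longrightarrow> T (s + t) x = T s (T t x)"
  and T_lim: "((\<lambda>t. T t x) \<longlongrightarrow> x) (at_right 0)"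
  using C0 by (auto simp: C0_semigroup_def)

lemma T_linear: "0 \<le> t \<Longrightarrow> bounded_linear (T t)"
  and T_scaleC: "0 \<le> t \<Longrightarrow> T t (c *\<^sub>C x) = c *\<^sub>C T t x"
  using T_clinear by (auto simp: bounded_clinear_def)

lemmas T_diff = linear_diff[OF bounded_linear.linear[OF T_linear]]
lemmas T_scaleR = linear_scale[OF bounded_linear.linear[OF T_linear]]
lemmas T_plus = linear_add[OF bounded_linear.linear[OF T_linear]]

lemma T_dist_bound:
  assumes "0 \<le> s" "s \<le> t"
  shows "norm (T t x - T s x) \<le> M * norm (T (t - s) x - x)"
proof -
  have "T t x - T s x = T s (T (t - s) x - x)"
    using assms T_add[of s "t - s" x] by (simp add: T_diff)
  then show ?thesis using bound[OF assms(1)] by simp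
qed

lemma T_continuous: "continuous_on {0..} (\<lambda>t. T t x)"
  unfolding continuous_on_iff
proof (intro ballI allI impI)
  fix t e :: real
  assume t: "t \<in> {0..}" and e: "0 < e"
  have "0 < e / M" using e M_ge_1 by simp
  then obtain d where d: "d > 0" "\<And>h. 0 < h \<Longrightarrow> h < d \<Longrightarrow> norm (T h x - x) < e / M"
    using tendstoD[OF T_lim, of "e / M" x]
    by (auto simp: eventually_at_right[of 0 1, simplified] dist_norm)
  have "dist (T u x) (T t x) < e" if u: "u \<in> {0..}" "dist u t < d" for u
  proof (cases "u = t")
    case False
    have "norm (T (max u t) x - T (min u t) x) \<le> M * norm (T (max u t - min u t) x - x)"
      using t u by (intro T_dist_bound) auto
    also have "\<dots> < M * (e / M)"
      using False u M_ge_1 by (intro mult_strict_left_mono d) (auto simp: dist_real_def max_def min_def)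
    finally show ?thesis
      using M_ge_1 by (auto simp: dist_norm max_def min_def norm_minus_commute split: if_splits)
  qed (use e in simp)
  with d(1) show "\<exists>d>0. \<forall>u\<in>{0..}. dist u t < d \<longrightarrow> dist (T u x) (T t x) < e"
    by blast
qed

lemma T_integrable: "0 \<le> a \<Longrightarrow> (\<lambda>t. T t x) integrable_on {a..b}"
  by (intro integrable_continuous_real continuous_on_subset[OF T_continuous]) auto

lemma norm_integral_T:
  assumes "0 \<le> \<tau>"
  shows "norm (integral {0..\<tau>} (\<lambda>t. T t x)) \<le> M * norm x * \<tau>"
proof -
  have "norm (integral {0..\<tau>} (\<lambda>t. T t x)) \<le> M * norm x * (\<tau> - 0)"
    using assms
    by (intro integral_bound continuous_on_subset[OF T_continuous]) (auto intro: bound)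
  then show ?thesis by simp
qed

lemma rescale_bounded_C0:
  assumes "0 \<le> Re s"
  shows "bounded_C0 (rescale s T) M"
proof
  have "bounded_clinear (rescale s T t)" if "0 \<le> t" for t
    using T_scaleC[OF that] bounded_linear_compose[OF bounded_linear_scaleC_right T_linear[OF that]]
    by (simp add: bounded_clinear_def rescale_def[abs_def] scaleC_scaleC mult.commute)
  moreover have "((\<lambda>t. rescale s T t x) \<longlongrightarrow> x) (at_right 0)" for x
  proof -
    have "((\<lambda>t::real. exp (- (s * of_real t))) \<longlongrightarrow> 1) (at_right 0)"
      by (auto intro!: tendsto_eq_intros)
    from tendsto_scaleC[OF this T_lim[of x]] show ?thesis
      by (simp add: rescale_def scaleC_one)
  qed
  ultimately show "C0_semigroup (rescale s T)"
    by (auto simp: C0_semigroup_def rescale_def T_0 T_add T_scaleC scaleC_one scaleC_scaleC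
        exp_add[symmetric] algebra_simps)
  show "norm (rescale s T t x) \<le> M * norm x" if "0 \<le> t" for t x
  proof -
    have "norm (rescale s T t x) \<le> 1 * norm (T t x)"
      unfolding rescale_def norm_scaleC using assms that
      by (intro mult_right_mono) (auto simp: norm_exp)
    with bound[OF that, of x] show ?thesis by simp
  qed
qed (rule M_ge_1)

lemma has_gen_T:
  assumes "has_gen T x y" "0 \<le> t"
  shows "has_gen T (T t x) (T t y)"
proof -
  have "((\<lambda>h. T t ((1 / h) *\<^sub>R (T h x - x))) \<longlongrightarrow> T t y) (at_right 0)"
    using assms unfolding has_gen_def by (intro bounded_linear.tendsto[OF T_linear])
  moreover have "\<forall>\<^sub>F h in at_right 0. T t ((1 / h) *\<^sub>R (T h x - x)) = (1 / h) *\<^sub>R (T h (T t x) - T t x)"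
    using eventually_at_right_less[of 0]
  proof eventually_elim
    case (elim h)
    then show ?case
      using assms(2) T_add[of t h x] T_add[of h t x]
      by (simp add: T_scaleR T_diff add.commute)
  qed
  ultimately show ?thesis
    unfolding has_gen_def by (rule Lim_transform_eventually)
qed

lemma has_gen_add: "has_gen T x y \<Longrightarrow> has_gen T x' y' \<Longrightarrow> has_gen T (x + x') (y + y')"
  unfolding has_gen_def
  by (drule (1) tendsto_add, erule Lim_transform_eventually)
    (auto simp: T_plus algebra_simps eventually_at_right_less intro!: eventually_mono[OF eventually_at_right_less[of 0]])

lemma has_gen_scaleC: "has_gen T x y \<Longrightarrow> has_gen T (c *\<^sub>C x) (c *\<^sub>C y)"
  unfolding has_gen_def
  by (drule bounded_linear.tendsto[OF bounded_linear_scaleC_right[of c]], erule Lim_transform_eventually)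
    (auto simp: T_scaleC scaleC_simps scaleC_scaleR intro!: eventually_mono[OF eventually_at_right_less[of 0]])

lemma T_average_tendsto:
  assumes "0 \<le> \<tau>"
  shows "((\<lambda>h. (1 / h) *\<^sub>R integral {\<tau>..\<tau> + h} (\<lambda>t. T t x)) \<longlongrightarrow> T \<tau> x) (at_right 0)"
proof -
  let ?F = "\<lambda>u. integral {\<tau>..u} (\<lambda>t. T t x)"
  have "(?F has_vector_derivative T \<tau> x) (at \<tau> within {\<tau>..\<tau> + 1})"
    using assms
    by (intro integral_has_vector_derivative continuous_on_subset[OF T_continuous]) auto
  then have "((\<lambda>u. (1 / \<bar>u - \<tau>\<bar>) *\<^sub>R (?F u - (u - \<tau>) *\<^sub>R T \<tau> x)) \<longlongrightarrow> 0) (at_right \<tau>)"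
    by (simp add: has_vector_derivative_def has_derivative_within at_within_Icc_at_right)
  then have "((\<lambda>h. (1 / \<bar>h\<bar>) *\<^sub>R (?F (\<tau> + h) - h *\<^sub>R T \<tau> x)) \<longlongrightarrow> 0) (at_right 0)"
    by (simp add: at_right_to_0[of \<tau>] filterlim_filtermap add.commute)
  from tendsto_add[OF this tendsto_const[of "T \<tau> x"]]
  have "((\<lambda>h. (1 / \<bar>h\<bar>) *\<^sub>R (?F (\<tau> + h) - h *\<^sub>R T \<tau> x) + T \<tau> x) \<longlongrightarrow> T \<tau> x) (at_right 0)"
    by simp
  then show ?thesis
    by (rule Lim_transform_eventually)
      (auto simp: scaleR_diff_right intro!: eventually_mono[OF eventually_at_right_less[of 0]])
qed

lemma T_integral:
  assumes "0 \<le> h" "0 \<le> a"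
  shows "T h (integral {a..b} (\<lambda>t. T t x)) = integral {a + h..b + h} (\<lambda>t. T t x)"
proof -
  have "T h (integral {a..b} (\<lambda>t. T t x)) = integral {a..b} (T h \<circ> (\<lambda>t. T t x))"
    using assms by (intro integral_linear[symmetric] T_integrable T_linear)
  also have "\<dots> = integral {a..b} ((\<lambda>t. T t x) \<circ> (+) h)"
    using assms by (intro integral_cong) (auto simp: T_add)
  finally show ?thesis by (simp only: integral_shift_Icc_real)
qed

text \<open>\<open>A \<integral>\<^sub>0\<^sup>\<tau> T(t) x dt = T(\<tau>) x - x\<close>, for every \<open>x\<close>.\<close>

lemma has_gen_integral:
  assumes \<tau>: "0 \<le> \<tau>"
  shows "has_gen T (integral {0..\<tau>} (\<lambda>t. T t x)) (T \<tau> x - x)"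
proof -
  let ?P = "\<lambda>a b. integral {a..b} (\<lambda>t. T t x)"
  have "((\<lambda>h. (1 / h) *\<^sub>R ?P \<tau> (\<tau> + h) - (1 / h) *\<^sub>R ?P 0 (0 + h)) \<longlongrightarrow> T \<tau> x - T 0 x) (at_right 0)"
    using \<tau> by (intro tendsto_diff T_average_tendsto) auto
  moreover have "\<forall>\<^sub>F h in at_right 0. (1 / h) *\<^sub>R ?P \<tau> (\<tau> + h) - (1 / h) *\<^sub>R ?P 0 (0 + h)
      = (1 / h) *\<^sub>R (T h (?P 0 \<tau>) - ?P 0 \<tau>)"
    using eventually_at_right_less[of 0]
  proof eventually_elim
    case (elim h)
    have "T h (?P 0 \<tau>) = ?P h (\<tau> + h)"
      using elim T_integral[of h 0 \<tau> x] by simp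
    moreover have "?P 0 h + ?P h (\<tau> + h) = ?P 0 (\<tau> + h)" "?P 0 \<tau> + ?P \<tau> (\<tau> + h) = ?P 0 (\<tau> + h)"
      using elim \<tau> by (auto intro!: Henstock_Kurzweil_Integration.integral_combine T_integrable)
    ultimately have "?P \<tau> (\<tau> + h) - ?P 0 (0 + h) = T h (?P 0 \<tau>) - ?P 0 \<tau>"
      by (simp add: diff_eq_eq) (simp add: algebra_simps)
    then show ?case
      by (simp only: scaleR_diff_right[symmetric])
  qed
  ultimately show ?thesis
    unfolding has_gen_def T_0 by (rule Lim_transform_eventually)
qed

lemma gen_dom_scaleR: "x \<in> gen_dom T \<Longrightarrow> r *\<^sub>R x \<in> gen_dom T"
  using has_gen_scaleC[of x _ "of_real r"] by (auto simp: gen_dom_iff scaleC_of_real)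

lemma gen_dom_dense: "\<exists>z. (\<forall>n::nat. z n \<in> gen_dom T) \<and> z \<longlonglongrightarrow> x"
proof -
  let ?z = "\<lambda>h. (1 / h) *\<^sub>R integral {0..h} (\<lambda>t. T t x)"
  have "filterlim (\<lambda>n. inverse (real (Suc n))) (at_right 0) sequentially"
    using LIMSEQ_inverse_real_of_nat by (auto simp: filterlim_at intro!: always_eventually)
  moreover have "(?z \<longlongrightarrow> x) (at_right 0)"
    using T_average_tendsto[of 0 x] by (simp add: T_0)
  ultimately have "(\<lambda>n. ?z (inverse (real (Suc n)))) \<longlonglongrightarrow> x"
    by (rule filterlim_compose[rotated])
  moreover have "?z h \<in> gen_dom T" if "0 \<le> h" for h
    using has_gen_imp[OF has_gen_integral[OF that]] by (intro gen_dom_scaleR) blast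
  ultimately show ?thesis
    by (intro exI[of _ "\<lambda>n. ?z (inverse (real (Suc n)))"]) simp
qed

section \<open>The resolvent\<close>

lemma rescale_decay:
  assumes "0 \<le> t"
  shows "norm (rescale s T t x) \<le> exp (- (Re s * t)) * (M * norm x)"
  unfolding rescale_def norm_scaleC using bound[OF assms]
  by (auto simp: norm_exp intro!: mult_left_mono)

lemma norm_T_iterate:
  assumes "0 \<le> h"
  shows "norm (T (real n * h) x - x) \<le> real n * (M * norm (T h x - x))"
proof (induction n)
  case (Suc n)
  have "T (real (Suc n) * h) x - x = T (real n * h) (T h x - x) + (T (real n * h) x - x)"
    using assms T_add[of "real n * h" h x] by (simp add: T_diff algebra_simps)
  then have "norm (T (real (Suc n) * h) x - x)
      \<le> norm (T (real n * h) (T h x - x)) + norm (T (real n * h) x - x)"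
    by (metis norm_triangle_ineq)
  also have "\<dots> \<le> M * norm (T h x - x) + real n * (M * norm (T h x - x))"
    using assms by (intro add_mono bound Suc.IH) simp
  finally show ?case by (simp add: algebra_simps)
qed (simp add: T_0)

text \<open>Cutting \<open>[0, t]\<close> into \<open>n\<close> equal pieces gives \<open>T(t) x - x\<close> as a sum of \<open>n\<close> terms of size
  \<open>o(1/n)\<close>; no differentiation of \<open>T(\<cdot>) x\<close> at positive times is needed.\<close>

lemma gen_kernel_fixed:
  assumes "has_gen T x 0" "0 \<le> t"
  shows "T t x = x"
proof (cases "t = 0")
  case False
  with assms have t: "0 < t" by simp
  let ?h = "\<lambda>n. t * inverse (real (Suc n))"
  have "(\<lambda>n. t * inverse (real (Suc n))) \<longlonglongrightarrow> t * 0"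
    by (intro tendsto_mult tendsto_const LIMSEQ_inverse_real_of_nat)
  then have "filterlim ?h (at_right 0) sequentially"
    using t by (auto simp: filterlim_at intro!: always_eventually)
  from filterlim_compose[OF assms(1)[unfolded has_gen_def] this]
  have "(\<lambda>n. (t * M) * norm ((1 / ?h n) *\<^sub>R (T (?h n) x - x))) \<longlonglongrightarrow> (t * M) * norm (0::'h)"
    by (intro tendsto_mult tendsto_norm tendsto_const)
  moreover have "norm (T t x - x) \<le> (t * M) * norm ((1 / ?h n) *\<^sub>R (T (?h n) x - x))" for n
  proof -
    have "norm (T (real (Suc n) * ?h n) x - x) \<le> real (Suc n) * (M * norm (T (?h n) x - x))"
      using t by (intro norm_T_iterate) simp
    moreover have "real (Suc n) * ?h n = t" by simp
    ultimately have "norm (T t x - x) \<le> (real (Suc n) * M) * norm (T (?h n) x - x)"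
      by (simp only: mult.assoc)
    also have "real (Suc n) * M = t * M * (1 / ?h n)" using t by (simp add: divide_inverse mult.commute)
    finally show ?thesis using t by (simp only: norm_scaleR mult.assoc) simp
  qed
  ultimately have "norm (T t x - x) \<le> (t * M) * norm (0::'h)"
    by (intro LIMSEQ_le_const) auto
  then show ?thesis by simp
qed (simp add: T_0)

lemma gen_eigenvector_zero:
  assumes "0 < Re s" "has_gen T y (s *\<^sub>C y)"
  shows "y = 0"
proof -
  interpret S: bounded_C0 "rescale s T" M
    using assms by (intro rescale_bounded_C0) simp
  have "has_gen (rescale s T) y 0"
    using assms(2) by (simp add: has_gen_rescale_iff)
  then have *: "norm y \<le> exp (- (Re s * t)) * (M * norm y)" if "0 \<le> t" for t
    using S.gen_kernel_fixed[of y t] rescale_decay[OF that, of s y] that by simp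
  have "filterlim (\<lambda>t. - (Re s * t)) at_bot at_top"
    by (rule filterlim_compose[OF filterlim_uminus_at_bot_at_top
        filterlim_tendsto_pos_mult_at_top[OF tendsto_const assms(1) filterlim_ident]])
  then have "((\<lambda>t. exp (- (Re s * t)) * (M * norm y)) \<longlongrightarrow> 0) at_top"
    by (intro tendsto_mult_left_zero filterlim_compose[OF exp_at_bot])
  then have "norm y \<le> 0"
    by (rule tendsto_lowerbound) (auto intro!: eventually_mono[OF eventually_ge_at_top[of 0]] *)
  then show ?thesis by simp
qed

text \<open>Surjectivity of \<open>s - A\<close>, with a bound on the preimage that need not be sharp. The preimage is
  the Laplace transform of the trajectory of \<open>x\<close>, obtained as a series of its integrals over
  \<open>[k, k + 1]\<close>; with \<open>S(t) = e\<^sup>-\<^sup>s\<^sup>t T(t)\<close> it satisfies \<open>S(h) y = y - \<integral>\<^sub>0\<^sup>h S(t) x dt\<close>, which shows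
  directly that \<open>(A - s) y = -x\<close>, without appeal to closedness of \<open>A\<close>.\<close>

lemma resolvent_exists:
  assumes s: "0 < Re s"
  shows "\<exists>K. \<forall>x. \<exists>y. has_gen T y (s *\<^sub>C y - x) \<and> norm y \<le> K * norm x"
proof -
  define q where "q = exp (- Re s)"
  have q: "0 < q" "q < 1" using s by (auto simp: q_def)
  interpret S: bounded_C0 "rescale s T" M
    using s by (intro rescale_bounded_C0) simp
  have "\<exists>y. has_gen T y (s *\<^sub>C y - x) \<and> norm y \<le> (M * M * suminf (\<lambda>k. q ^ k)) * norm x" for x
  proof -
    let ?P = "\<lambda>a b. integral {a..b} (\<lambda>t. rescale s T t x)"
    let ?u = "\<lambda>k::nat. rescale s T (real k) (?P 0 1)"
    have exp_q: "exp (- (Re s * real k)) = q ^ k" for k :: nat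
      by (simp add: q_def exp_of_nat_mult[symmetric] mult.commute)
    have u: "norm (?u k) \<le> q ^ k * (M * (M * norm x))" for k
    proof -
      have "norm (?u k) \<le> q ^ k * (M * norm (?P 0 1))"
        using rescale_decay[of "real k" s "?P 0 1"] by (simp add: exp_q)
      also have "\<dots> \<le> q ^ k * (M * (M * norm x))"
        using S.norm_integral_T[of 1 x] q M_ge_1 by (intro mult_left_mono) auto
      finally show ?thesis .
    qed
    have summable_q: "summable (\<lambda>k. q ^ k)" using q by (simp add: summable_geometric)
    have "summable ?u"
      by (rule summable_comparison_test'[OF summable_mult2[OF summable_q] u])
    then have sums: "(\<lambda>n. \<Sum>k<n. ?u k) \<longlonglongrightarrow> suminf ?u"
      by (rule summable_LIMSEQ)
    have partial: "(\<Sum>k<n. ?u k) = ?P 0 (real n)" for n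
    proof (induction n)
      case (Suc n)
      have "?u n = ?P (real n) (1 + real n)"
        using S.T_integral[of "real n" 0 1 x] by simp
      moreover have "?P 0 (real n) + ?P (real n) (1 + real n) = ?P 0 (1 + real n)"
        by (intro Henstock_Kurzweil_Integration.integral_combine S.T_integrable) auto
      ultimately show ?case using Suc by simp
    qed simp
    define y where "y = suminf ?u"
    have lim: "(\<lambda>n. ?P 0 (real n)) \<longlonglongrightarrow> y"
      using sums by (simp add: partial y_def)
    have norm_y: "norm y \<le> (M * M * suminf (\<lambda>k. q ^ k)) * norm x"
    proof -
      have "norm y \<le> (\<Sum>k. q ^ k * (M * (M * norm x)))"
        unfolding y_def by (rule norm_suminf_le[OF u summable_mult2[OF summable_q]])
      also have "\<dots> = (\<Sum>k. q ^ k) * (M * (M * norm x))"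
        by (rule suminf_mult2[OF summable_q, symmetric])
      finally show ?thesis by (simp add: mult_ac)
    qed
    have shift: "rescale s T h y = y - ?P 0 h" if h: "0 \<le> h" for h
    proof -
      have "rescale s T h (?P 0 (real n)) = ?P 0 (real n) + rescale s T (real n) (?P 0 h) - ?P 0 h" for n
      proof -
        have "rescale s T h (?P 0 (real n)) = ?P h (real n + h)"
          using S.T_integral[OF h, of 0 "real n" x] by simp
        moreover have "rescale s T (real n) (?P 0 h) = ?P (real n) (real n + h)"
          using S.T_integral[of "real n" 0 h x] by (simp add: add.commute)
        moreover have "?P 0 h + ?P h (real n + h) = ?P 0 (real n + h)"
          "?P 0 (real n) + ?P (real n) (real n + h) = ?P 0 (real n + h)"
          using h by (auto intro!: Henstock_Kurzweil_Integration.integral_combine S.T_integrable)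
        ultimately show ?thesis by (simp add: algebra_simps)
      qed
      moreover have "(\<lambda>n. rescale s T (real n) (?P 0 h)) \<longlonglongrightarrow> 0"
      proof (rule Lim_null_comparison)
        show "\<forall>\<^sub>F n in sequentially. norm (rescale s T (real n) (?P 0 h)) \<le> q ^ n * (M * norm (?P 0 h))"
          using rescale_decay[of _ s "?P 0 h"] by (intro always_eventually) (simp flip: exp_q)
        show "(\<lambda>n. q ^ n * (M * norm (?P 0 h))) \<longlonglongrightarrow> 0"
          using q by (intro tendsto_mult_left_zero LIMSEQ_realpow_zero) auto
      qed
      then have "(\<lambda>n. ?P 0 (real n) + rescale s T (real n) (?P 0 h) - ?P 0 h) \<longlonglongrightarrow> y + 0 - ?P 0 h"
        by (intro tendsto_intros lim)
      moreover have "(\<lambda>n. rescale s T h (?P 0 (real n))) \<longlonglongrightarrow> rescale s T h y"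
        using h lim by (intro bounded_linear.tendsto[OF S.T_linear])
      ultimately show ?thesis using LIMSEQ_unique by (simp del: add_0_right) force
    qed
    have "((\<lambda>h. - ((1 / h) *\<^sub>R ?P 0 (0 + h))) \<longlongrightarrow> - rescale s T 0 x) (at_right 0)"
      by (intro tendsto_minus S.T_average_tendsto) simp
    then have "has_gen (rescale s T) y (- x)"
      unfolding has_gen_def S.T_0
      by (rule Lim_transform_eventually)
        (auto simp: shift intro!: eventually_mono[OF eventually_at_right_less[of 0]])
    then show ?thesis
      using norm_y by (auto simp: has_gen_rescale_iff)
  qed
  then show ?thesis by blast
qed

lemma resolvent_eq:
  assumes s: "0 < Re s" and y: "has_gen T y (s *\<^sub>C y - x)"
  shows "resolvent T s x = y"
proof -
  have "inj_on (\<lambda>y. s *\<^sub>C y - gen T y) (gen_dom T)"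
  proof (rule inj_onI)
    fix u v
    assume uv: "u \<in> gen_dom T" "v \<in> gen_dom T" "s *\<^sub>C u - gen T u = s *\<^sub>C v - gen T v"
    have "has_gen T (u + (- 1) *\<^sub>C v) (gen T u + (- 1) *\<^sub>C gen T v)"
      using uv by (intro has_gen_add has_gen_scaleC has_gen_gen)
    moreover have "gen T u - gen T v = s *\<^sub>C (u - v)"
      using uv(3)[symmetric] by (simp add: scaleC_simps algebra_simps)
    ultimately have "has_gen T (u - v) (s *\<^sub>C (u - v))"
      by (simp add: scaleC_simps scaleC_one)
    then have "u - v = 0"
      by (rule gen_eigenvector_zero[OF s])
    then show "u = v" by simp
  qed
  moreover have "y \<in> gen_dom T" "s *\<^sub>C y - gen T y = x"
    using has_gen_imp[OF y] by simp_all
  ultimately show ?thesis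
    unfolding resolvent_def using the_inv_into_f_eq[of "\<lambda>y. s *\<^sub>C y - gen T y" "gen_dom T" y x] by blast
qed

lemma has_gen_resolvent:
  assumes "0 < Re s"
  shows "has_gen T (resolvent T s x) (s *\<^sub>C resolvent T s x - x)"
proof -
  obtain y where "has_gen T y (s *\<^sub>C y - x)"
    using resolvent_exists[OF assms] by blast
  then show ?thesis by (simp add: resolvent_eq[OF assms])
qed

lemma resolvent_inverse:
  assumes "0 < Re s" "x \<in> gen_dom T"
  shows "resolvent T s (s *\<^sub>C x - gen T x) = x"
  using has_gen_gen[OF assms(2)] by (intro resolvent_eq assms(1)) simp

lemma resolvent_in_gen_dom:
  assumes "0 < Re s"
  shows "resolvent T s x \<in> gen_dom T"
  using has_gen_imp[OF has_gen_resolvent[OF assms]] by (rule conjunct1)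

lemma resolvent_add:
  assumes "0 < Re s"
  shows "resolvent T s (x + y) = resolvent T s x + resolvent T s y"
proof (rule resolvent_eq[OF assms])
  have "s *\<^sub>C (resolvent T s x + resolvent T s y) - (x + y)
      = (s *\<^sub>C resolvent T s x - x) + (s *\<^sub>C resolvent T s y - y)"
    by (simp add: scaleC_add_right)
  then show "has_gen T (resolvent T s x + resolvent T s y)
      (s *\<^sub>C (resolvent T s x + resolvent T s y) - (x + y))"
    using has_gen_add[OF has_gen_resolvent[OF assms] has_gen_resolvent[OF assms]] by metis
qed

lemma resolvent_scaleC:
  assumes "0 < Re s"
  shows "resolvent T s (c *\<^sub>C x) = c *\<^sub>C resolvent T s x"
proof (rule resolvent_eq[OF assms])
  have "s *\<^sub>C c *\<^sub>C resolvent T s x - c *\<^sub>C x = c *\<^sub>C (s *\<^sub>C resolvent T s x - x)"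
    by (simp only: scaleC_simps scaleC_scaleC mult.commute)
  then show "has_gen T (c *\<^sub>C resolvent T s x) (s *\<^sub>C c *\<^sub>C resolvent T s x - c *\<^sub>C x)"
    using has_gen_scaleC[OF has_gen_resolvent[OF assms]] by metis
qed

lemma resolvent_bounded:
  assumes "0 < Re s"
  shows "\<exists>K. \<forall>x. norm (resolvent T s x) \<le> K * norm x"
proof -
  obtain K where K: "\<And>x. \<exists>y. has_gen T y (s *\<^sub>C y - x) \<and> norm y \<le> K * norm x"
    using resolvent_exists[OF assms] by blast
  have "norm (resolvent T s x) \<le> K * norm x" for x
    using K[of x] resolvent_eq[OF assms, of _ x] by auto
  then show ?thesis by blast
qed

lemma bounded_linear_resolvent:
  assumes "0 < Re s"
  shows "bounded_linear (resolvent T s)"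
proof -
  obtain K where "\<And>x. norm (resolvent T s x) \<le> K * norm x"
    using resolvent_bounded[OF assms] by blast
  then show ?thesis
    using resolvent_scaleC[OF assms, of "of_real r" for r]
    by (intro bounded_linear_intro[where K = K] resolvent_add assms)
      (auto simp: scaleC_of_real mult.commute)
qed

lemma resolvent_rescale:
  assumes "0 < Re s" "0 \<le> t"
  shows "resolvent T s (rescale a T t x) = rescale a T t (resolvent T s x)"
proof -
  have "resolvent T s (T t x) = T t (resolvent T s x)"
    using has_gen_T[OF has_gen_resolvent[OF assms(1)] assms(2), of x] assms
    by (intro resolvent_eq) (auto simp: T_diff T_scaleC)
  then show ?thesis by (simp add: rescale_def resolvent_scaleC assms)
qed

text \<open>With \<open>S(t) = e\<^sup>-\<^sup>a\<^sup>t T(t)\<close> and \<open>p = \<integral>\<^sub>0\<^sup>\<tau> S(t) x dt\<close>, this is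
  \<open>(s - A) p = (s - a) p + x - S(\<tau>) x\<close>.\<close>

lemma integral_rescale_eq_resolvent:
  fixes \<tau> a x
  assumes "0 < Re s" "0 \<le> Re a" "0 \<le> \<tau>"
  defines "p \<equiv> integral {0..\<tau>} (\<lambda>t. rescale a T t x)"
  shows "p = resolvent T s ((s - a) *\<^sub>C p + x - rescale a T \<tau> x)"
proof -
  interpret S: bounded_C0 "rescale a T" M
    using assms by (intro rescale_bounded_C0)
  have "has_gen T p (rescale a T \<tau> x - x + a *\<^sub>C p)"
    using S.has_gen_integral[OF assms(3), of x] by (simp add: has_gen_rescale_iff p_def)
  then show ?thesis
    using assms(1) by (intro resolvent_eq[symmetric]) (auto simp: scaleC_simps algebra_simps)
qed

end
section \<open>Observation along trajectories\<close>

text \<open>The windowed Fourier integral \<open>\<integral>\<^sub>a\<^sup>b e\<^sup>i\<^sup>\<omega>\<^sup>t C T(t) x dt\<close> of an output.\<close>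

definition output_integral ::
    "(real \<Rightarrow> 'a::complex_inner \<Rightarrow> 'a) \<Rightarrow> ('a \<Rightarrow> 'b::complex_inner) \<Rightarrow> real \<Rightarrow> real \<Rightarrow> real \<Rightarrow> 'a \<Rightarrow> 'b"
  where "output_integral T C \<omega> a b x =
    integral {a..b} (\<lambda>t. exp (\<i> * of_real (\<omega> * t)) *\<^sub>C C (T t x))"

text \<open>Integration by parts removes the weight \<open>e\<^sup>-\<^sup>r\<^sup>t\<close> in front of \<open>f\<close>.\<close>

lemma norm_integral_exp_weight:
  fixes f :: "real \<Rightarrow> 'a::banach"
  assumes r: "0 \<le> r" and \<tau>: "0 \<le> \<tau>" and f: "continuous_on {0..\<tau>} f"
    and b: "\<And>t. 0 \<le> t \<Longrightarrow> t \<le> \<tau> \<Longrightarrow> norm (integral {0..t} f) \<le> b"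
  shows "norm (integral {0..\<tau>} (\<lambda>t. exp (- (r * t)) *\<^sub>R f t)) \<le> (1 + r * \<tau>) * b"
proof -
  let ?F = "\<lambda>t. integral {0..t} f"
  let ?e = "\<lambda>t. exp (- (r * t))"
  have F: "(?F has_vector_derivative f t) (at t within {0..\<tau>})" if "t \<in> {0..\<tau>}" for t
    using f that by (rule integral_has_vector_derivative)
  have F_cont: "continuous_on {0..\<tau>} ?F"
    using F by (rule continuous_on_vector_derivative)
  have "((\<lambda>t. ?e t *\<^sub>R f t + (- r * ?e t) *\<^sub>R ?F t) has_integral ?e \<tau> *\<^sub>R ?F \<tau> - ?e 0 *\<^sub>R ?F 0) {0..\<tau>}"
    by (rule fundamental_theorem_of_calculus[OF \<tau>],
        rule has_vector_derivative_scaleR[OF _ F])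
      (auto intro!: derivative_eq_intros)
  then have sum: "integral {0..\<tau>} (\<lambda>t. ?e t *\<^sub>R f t + (- r * ?e t) *\<^sub>R ?F t) = ?e \<tau> *\<^sub>R ?F \<tau>"
    by (simp add: integral_unique)
  have int1: "(\<lambda>t. ?e t *\<^sub>R f t) integrable_on {0..\<tau>}"
    and cont2: "continuous_on {0..\<tau>} (\<lambda>t. (- r * ?e t) *\<^sub>R ?F t)"
    by (intro integrable_continuous_real continuous_intros f F_cont)+
  have "integral {0..\<tau>} (\<lambda>t. ?e t *\<^sub>R f t) + integral {0..\<tau>} (\<lambda>t. (- r * ?e t) *\<^sub>R ?F t) = ?e \<tau> *\<^sub>R ?F \<tau>"
    using sum integral_add[OF int1 integrable_continuous_real[OF cont2]] by simp
  then have eq: "integral {0..\<tau>} (\<lambda>t. ?e t *\<^sub>R f t) = ?e \<tau> *\<^sub>R ?F \<tau> - integral {0..\<tau>} (\<lambda>t. (- r * ?e t) *\<^sub>R ?F t)"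
    by (simp only: eq_diff_eq)
  have e_le: "?e t \<le> 1" if "0 \<le> t" for t using r that by simp
  have b0: "0 \<le> b" using b[of 0] \<tau> by simp
  have "norm (?e \<tau> *\<^sub>R ?F \<tau>) \<le> 1 * b"
    unfolding norm_scaleR using e_le[OF \<tau>] b[OF \<tau>] by (intro mult_mono) auto
  moreover have "norm (integral {0..\<tau>} (\<lambda>t. (- r * ?e t) *\<^sub>R ?F t)) \<le> (r * b) * (\<tau> - 0)"
  proof (rule integral_bound[OF \<tau> cont2])
    fix t assume t: "t \<in> {0..\<tau>}"
    have "r * ?e t * norm (?F t) \<le> r * 1 * b"
      using t r b0 by (intro mult_mono mult_left_mono e_le b mult_nonneg_nonneg) auto
    then show "norm ((- r * ?e t) *\<^sub>R ?F t) \<le> r * b"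
      using r by (simp add: abs_mult)
  qed
  ultimately show ?thesis
    unfolding eq using norm_triangle_ineq4[of "?e \<tau> *\<^sub>R ?F \<tau>" "integral {0..\<tau>} (\<lambda>t. (- r * ?e t) *\<^sub>R ?F t)"]
    by (simp add: algebra_simps)
qed

text \<open>A bounded \<open>C\<^sub>0\<close>-semigroup with an observation operator \<open>C \<in> L(D(A), Y)\<close>.\<close>

locale observed_semigroup = bounded_C0 T M
  for T :: "real \<Rightarrow> 'h::complex_hilbert_space \<Rightarrow> 'h" and M +
  fixes C :: "'h \<Rightarrow> 'y::complex_hilbert_space"
  assumes obs: "observation_operator T C"
begin

lemma C_add: "x \<in> gen_dom T \<Longrightarrow> y \<in> gen_dom T \<Longrightarrow> C (x + y) = C x + C y"
  and C_scaleC: "x \<in> gen_dom T \<Longrightarrow> C (c *\<^sub>C x) = c *\<^sub>C C x"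
  using obs by (auto simp: observation_operator_def)

text \<open>\<open>C\<close> is bounded only in the graph norm, but \<open>C (s - A)\<^sup>-\<^sup>1\<close> is bounded on the whole space.\<close>

lemma bounded_linear_C_resolvent:
  assumes s: "0 < Re s"
  shows "bounded_linear (\<lambda>x. C (resolvent T s x))"
proof -
  obtain K where K: "\<And>x. norm (resolvent T s x) \<le> K * norm x"
    using resolvent_bounded[OF s] by blast
  obtain L where L: "\<And>x. x \<in> gen_dom T \<Longrightarrow> norm (C x) \<le> L * graph_norm T x"
    using obs unfolding observation_operator_def by blast
  have "norm (C (resolvent T s x)) \<le> norm x * (\<bar>L\<bar> * (K + cmod s * K + 1))" for x
  proof -
    let ?y = "resolvent T s x"
    have "gen T ?y = s *\<^sub>C ?y - x"
      using has_gen_imp[OF has_gen_resolvent[OF s]] by blast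
    then have "graph_norm T ?y \<le> norm ?y + (cmod s * norm ?y + norm x)"
      using norm_triangle_ineq4[of "s *\<^sub>C ?y" x] by (simp add: graph_norm_def norm_scaleC)
    also have "\<dots> \<le> K * norm x + (cmod s * (K * norm x) + norm x)"
      by (intro add_mono mult_left_mono K) auto
    finally have g: "graph_norm T ?y \<le> K * norm x + (cmod s * (K * norm x) + norm x)" .
    have "norm (C ?y) \<le> L * graph_norm T ?y"
      by (intro L resolvent_in_gen_dom s)
    also have "\<dots> \<le> \<bar>L\<bar> * graph_norm T ?y"
      by (intro mult_right_mono) (auto simp: graph_norm_def)
    also have "\<dots> \<le> \<bar>L\<bar> * (K * norm x + (cmod s * (K * norm x) + norm x))"
      by (intro mult_left_mono g) simp
    finally show ?thesis by (simp add: algebra_simps)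
  qed
  moreover have "C (resolvent T s (r *\<^sub>R x)) = r *\<^sub>R C (resolvent T s x)" for r x
    using resolvent_scaleC[OF s, of "of_real r" x]
      C_scaleC[OF resolvent_in_gen_dom[OF s], of "of_real r" x]
    by (simp add: scaleC_of_real)
  ultimately show ?thesis
    by (intro bounded_linear_intro) (auto simp: resolvent_add C_add resolvent_in_gen_dom s)
qed

text \<open>For \<open>x \<in> D(A)\<close> one has \<open>C T(t) x = C (1 - A)\<^sup>-\<^sup>1 T(t) (1 - A) x\<close>. This makes outputs
  continuous and lets \<open>C\<close> be exchanged with integrals over trajectories.\<close>

lemma
  assumes x: "x \<in> gen_dom T" and a: "0 \<le> Re a"
  shows continuous_output:
      "continuous_on {0..} (\<lambda>t. exp (- (a * of_real t)) *\<^sub>C C (T t x))"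
    and integral_output: "0 \<le> \<tau> \<Longrightarrow> integral {0..\<tau>} (\<lambda>t. exp (- (a * of_real t)) *\<^sub>C C (T t x))
      = C (integral {0..\<tau>} (\<lambda>t. rescale a T t x))"
proof -
  interpret S: bounded_C0 "rescale a T" M using a by (rule rescale_bounded_C0)
  let ?R = "resolvent T 1"
  define z where "z = 1 *\<^sub>C x - gen T x"
  have Rz: "?R z = x" unfolding z_def using x by (intro resolvent_inverse) simp
  have out: "exp (- (a * of_real t)) *\<^sub>C C (T t x) = C (?R (rescale a T t z))" if "0 \<le> t" for t
  proof -
    have "T t x \<in> gen_dom T"
      using has_gen_T[OF has_gen_gen[OF x] that] has_gen_imp by blast
    then have "exp (- (a * of_real t)) *\<^sub>C C (T t x) = C (rescale a T t x)"
      by (simp add: C_scaleC rescale_def)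
    then show ?thesis using that by (simp add: resolvent_rescale Rz)
  qed
  have B: "bounded_linear (\<lambda>x. C (?R x))" by (rule bounded_linear_C_resolvent) simp
  have "continuous_on {0..} (\<lambda>t. C (?R (rescale a T t z)))"
    by (rule bounded_linear.continuous_on[OF B S.T_continuous])
  then show "continuous_on {0..} (\<lambda>t. exp (- (a * of_real t)) *\<^sub>C C (T t x))"
    by (rule continuous_on_eq) (simp add: out)
  assume \<tau>: "0 \<le> \<tau>"
  have "integral {0..\<tau>} (\<lambda>t. exp (- (a * of_real t)) *\<^sub>C C (T t x))
      = integral {0..\<tau>} ((\<lambda>x. C (?R x)) \<circ> (\<lambda>t. rescale a T t z))"
    by (intro integral_cong) (simp add: out)
  also have "\<dots> = C (?R (integral {0..\<tau>} (\<lambda>t. rescale a T t z)))"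
    by (rule integral_linear[OF _ B]) (simp add: S.T_integrable)
  also have "?R (integral {0..\<tau>} (\<lambda>t. rescale a T t z))
      = integral {0..\<tau>} (?R \<circ> (\<lambda>t. rescale a T t z))"
    by (intro integral_linear[symmetric] S.T_integrable bounded_linear_resolvent) auto
  also have "\<dots> = integral {0..\<tau>} (\<lambda>t. rescale a T t x)"
    by (intro integral_cong) (simp add: resolvent_rescale Rz)
  finally show "integral {0..\<tau>} (\<lambda>t. exp (- (a * of_real t)) *\<^sub>C C (T t x))
      = C (integral {0..\<tau>} (\<lambda>t. rescale a T t x))" .
qed

lemma exp_frequency: "exp (\<i> * of_real (\<omega> * t)) = exp (- ((- (\<i> * of_real \<omega>)) * of_real t))"
  by (simp add: mult.assoc)

lemma continuous_frequency:
  "x \<in> gen_dom T \<Longrightarrow> continuous_on {0..} (\<lambda>t. exp (\<i> * of_real (\<omega> * t)) *\<^sub>C C (T t x))"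
  unfolding exp_frequency by (rule continuous_output) auto

text \<open>The core of (B1) implies (B2a): the frequency \<open>\<omega>\<close> and the window length \<open>\<tau>\<close> correspond to
  \<open>s = 1/\<tau> - i\<omega>\<close>.\<close>

lemma output_integral_le_resolvent:
  assumes \<tau>: "0 < \<tau>" and x: "x \<in> gen_dom T"
    and s: "s = Complex (1 / \<tau>) (- \<omega>)"
    and b: "\<And>z. norm (C (resolvent T s z)) \<le> b * norm z"
  shows "norm (output_integral T C \<omega> 0 \<tau> x) \<le> \<bar>b\<bar> * ((2 * M + 1) * norm x)"
proof -
  define a where "a = - (\<i> * of_real \<omega>)"
  have a: "0 \<le> Re a" by (simp add: a_def)
  interpret S: bounded_C0 "rescale a T" M using a by (rule rescale_bounded_C0)
  define p where "p = integral {0..\<tau>} (\<lambda>t. rescale a T t x)"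
  define z where "z = (s - a) *\<^sub>C p + x - rescale a T \<tau> x"
  have sa: "s - a = of_real (1 / \<tau>)" by (simp add: s a_def complex_eq_iff)
  have "p = resolvent T s z"
    unfolding p_def z_def using \<tau> a by (intro integral_rescale_eq_resolvent) (auto simp: s)
  moreover have "output_integral T C \<omega> 0 \<tau> x = C p"
    unfolding output_integral_def exp_frequency p_def a_def[symmetric]
    using x a \<tau> by (intro integral_output) auto
  ultimately have "norm (output_integral T C \<omega> 0 \<tau> x) \<le> b * norm z"
    using b by simp
  also have "\<dots> \<le> \<bar>b\<bar> * norm z"
    by (intro mult_right_mono) auto
  also have "\<dots> \<le> \<bar>b\<bar> * ((2 * M + 1) * norm x)"
  proof (intro mult_left_mono)
    have "norm z \<le> norm ((s - a) *\<^sub>C p) + norm x + norm (rescale a T \<tau> x)"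
      unfolding z_def by (meson add_mono norm_triangle_ineq norm_triangle_ineq4 order_refl order_trans)
    moreover have "norm ((s - a) *\<^sub>C p) \<le> M * norm x"
      using S.norm_integral_T[of \<tau> x] \<tau>
      by (simp add: sa norm_scaleC p_def[symmetric] norm_divide divide_simps del: of_real_divide)
    ultimately show "norm z \<le> (2 * M + 1) * norm x"
      using S.bound[of \<tau> x] \<tau> by (simp add: algebra_simps)
  qed simp
  finally show ?thesis .
qed

text \<open>The core of (B2a) implies (B1). The window length \<open>\<tau> = ln (2M) / Re s\<close> makes
  \<open>e\<^sup>-\<^sup>s\<^sup>\<tau> T(\<tau>)\<close> have norm at most \<open>1/2\<close>, and
  \<open>C (s - A)\<^sup>-\<^sup>1 x = \<integral>\<^sub>0\<^sup>\<tau> e\<^sup>-\<^sup>s\<^sup>t C T(t) x dt + C (s - A)\<^sup>-\<^sup>1 e\<^sup>-\<^sup>s\<^sup>\<tau> T(\<tau>) x\<close>, so the last term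
  can be absorbed.\<close>

lemma resolvent_le_output_integral:
  assumes s: "0 < Re s" and \<tau>: "\<tau> = ln (2 * M) / Re s"
    and b: "\<And>t x. 0 \<le> t \<Longrightarrow> t \<le> \<tau> \<Longrightarrow> x \<in> gen_dom T \<Longrightarrow>
      norm (output_integral T C (- Im s) 0 t x) \<le> b * norm x"
    and b0: "0 \<le> b"
  shows "norm (C (resolvent T s x)) \<le> 2 * (1 + ln (2 * M)) * b * norm x"
proof -
  interpret S: bounded_C0 "rescale s T" M using s by (intro rescale_bounded_C0) simp
  let ?B = "\<lambda>x. C (resolvent T s x)"
  define k where "k = (1 + ln (2 * M)) * b"
  have lnM: "0 < ln (2 * M)" using M_ge_1 by simp
  have \<tau>0: "0 < \<tau>" using s lnM by (simp add: \<tau>)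
  have r\<tau>: "Re s * \<tau> = ln (2 * M)" using s by (simp add: \<tau>)
  have k0: "0 \<le> k" using lnM b0 by (simp add: k_def)
  have B: "bounded_linear ?B" by (rule bounded_linear_C_resolvent[OF s])
  \<comment> \<open>first on \<open>D(A)\<close>, where outputs are defined; density extends the estimate to all states\<close>
  have step: "norm (?B x) \<le> (k + onorm ?B / 2) * norm x" if x: "x \<in> gen_dom T" for x
  proof -
    let ?G = "integral {0..\<tau>} (\<lambda>t. rescale s T t x)"
    let ?f = "\<lambda>t. exp (\<i> * of_real (- Im s * t)) *\<^sub>C C (T t x)"
    have "?G = resolvent T s (x - rescale s T \<tau> x)"
      using integral_rescale_eq_resolvent[of s s \<tau> x] s \<tau>0 by (simp add: scaleC_simps)
    then have "?B x = C ?G + ?B (rescale s T \<tau> x)"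
      using linear_diff[OF bounded_linear.linear[OF B], of x "rescale s T \<tau> x"] by simp
    moreover have "norm (C ?G) \<le> k * norm x"
    proof -
      have "C ?G = integral {0..\<tau>} (\<lambda>t. exp (- (s * of_real t)) *\<^sub>C C (T t x))"
        using x s \<tau>0 by (intro integral_output[symmetric]) auto
      also have "\<dots> = integral {0..\<tau>} (\<lambda>t. exp (- (Re s * t)) *\<^sub>R ?f t)"
      proof (intro integral_cong)
        fix t
        have "- (s * of_real t) = of_real (- (Re s * t)) + \<i> * of_real (- Im s * t)"
          by (simp add: complex_eq_iff)
        then have "exp (- (s * of_real t)) = of_real (exp (- (Re s * t))) * exp (\<i> * of_real (- Im s * t))"
          by (simp only: exp_add exp_of_real)
        then show "exp (- (s * of_real t)) *\<^sub>C C (T t x) = exp (- (Re s * t)) *\<^sub>R ?f t"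
          by (simp only: scaleC_scaleC[symmetric] scaleC_of_real)
      qed
      also have "norm \<dots> \<le> (1 + Re s * \<tau>) * (b * norm x)"
      proof (rule norm_integral_exp_weight)
        show "continuous_on {0..\<tau>} ?f"
          by (rule continuous_on_subset[OF continuous_frequency[OF x]]) simp
        show "norm (integral {0..t} ?f) \<le> b * norm x" if "0 \<le> t" "t \<le> \<tau>" for t
          using b[OF that x] by (simp only: output_integral_def)
      qed (use s \<tau>0 in simp_all)
      finally have "norm (C ?G) \<le> (1 + Re s * \<tau>) * (b * norm x)" .
      then show ?thesis by (simp add: k_def r\<tau>)
    qed
    moreover have "norm (?B (rescale s T \<tau> x)) \<le> onorm ?B / 2 * norm x"
    proof -
      have "exp (- (Re s * \<tau>)) = inverse (2 * M)"
        using M_ge_1 by (simp add: r\<tau> exp_minus)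
      then have "exp (- (Re s * \<tau>)) * (M * norm x) = inverse (2 * M) * (M * norm x)"
        by (rule arg_cong)
      also have "\<dots> = norm x / 2"
        using M_ge_1 by (simp add: field_simps)
      finally have "exp (- (Re s * \<tau>)) * (M * norm x) = norm x / 2" .
      then have "norm (rescale s T \<tau> x) \<le> norm x / 2"
        using rescale_decay[of \<tau> s x] \<tau>0 by linarith
      then have "onorm ?B * norm (rescale s T \<tau> x) \<le> onorm ?B * (norm x / 2)"
        by (intro mult_left_mono onorm_pos_le B)
      then show ?thesis using onorm[OF B, of "rescale s T \<tau> x"] by simp
    qed
    ultimately show ?thesis
      using norm_triangle_ineq[of "C ?G" "?B (rescale s T \<tau> x)"] by (simp add: algebra_simps)
  qed
  have "norm (?B x) \<le> (k + onorm ?B / 2) * norm x" for x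
  proof -
    obtain z where z: "\<And>n::nat. z n \<in> gen_dom T" "z \<longlonglongrightarrow> x"
      using gen_dom_dense by blast
    have "(\<lambda>n. norm (?B (z n))) \<longlonglongrightarrow> norm (?B x)"
      by (intro tendsto_norm bounded_linear.tendsto[OF B] z)
    moreover have "(\<lambda>n. (k + onorm ?B / 2) * norm (z n)) \<longlonglongrightarrow> (k + onorm ?B / 2) * norm x"
      by (intro tendsto_intros z)
    ultimately show ?thesis
      by (rule LIMSEQ_le) (use step z(1) in auto)
  qed
  then have "onorm ?B \<le> k + onorm ?B / 2"
    using k0 onorm_pos_le[OF B] by (intro onorm_bound) auto
  then have "onorm ?B * norm x \<le> (2 * k) * norm x"
    by (intro mult_right_mono) auto
  with onorm[OF B, of x] have "norm (?B x) \<le> (2 * k) * norm x" by linarith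
  then show ?thesis by (simp only: k_def mult.assoc)
qed

lemma output_integral_shift:
  assumes \<tau>: "0 \<le> \<tau>" and x: "x \<in> gen_dom T"
  shows "output_integral T C \<omega> \<tau> (2 * \<tau>) x
    = exp (\<i> * of_real (\<omega> * \<tau>)) *\<^sub>C output_integral T C \<omega> 0 \<tau> (T \<tau> x)"
proof -
  let ?e = "\<lambda>t. exp (\<i> * of_real (\<omega> * t))"
  have "output_integral T C \<omega> \<tau> (2 * \<tau>) x = integral {0 + \<tau>..\<tau> + \<tau>} (\<lambda>t. ?e t *\<^sub>C C (T t x))"
    by (simp add: output_integral_def)
  also have "\<dots> = integral {0..\<tau>} ((\<lambda>t. ?e t *\<^sub>C C (T t x)) \<circ> (+) \<tau>)"
    by (rule integral_shift_Icc_real[symmetric])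
  also have "\<dots> = integral {0..\<tau>} ((\<lambda>y. ?e \<tau> *\<^sub>C y) \<circ> (\<lambda>t. ?e t *\<^sub>C C (T t (T \<tau> x))))"
    using \<tau> by (intro integral_cong)
      (simp add: T_add[symmetric] scaleC_scaleC exp_add[symmetric] algebra_simps)
  also have "\<dots> = ?e \<tau> *\<^sub>C output_integral T C \<omega> 0 \<tau> (T \<tau> x)"
    unfolding output_integral_def
  proof (intro integral_linear bounded_linear_scaleC_right integrable_continuous_real)
    have "T \<tau> x \<in> gen_dom T"
      using has_gen_T[OF has_gen_gen[OF x] \<tau>] has_gen_imp by blast
    then show "continuous_on {0..\<tau>} (\<lambda>t. ?e t *\<^sub>C C (T t (T \<tau> x)))"
      by (rule continuous_on_subset[OF continuous_frequency]) auto
  qed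
  finally show ?thesis .
qed

text \<open>The core of (B2b) implies (B2a): the interval \<open>(0, \<tau>]\<close> is the union of the intervals
  \<open>[\<tau>/2\<^bsup>n+1\<^esup>, \<tau>/2\<^bsup>n\<^esup>]\<close>. The constant \<open>3\<close> is an upper bound of \<open>\<Sum>\<^sub>n 2\<^bsup>-(n+1)/2\<^esup>\<close>.\<close>

lemma output_integral_dyadic:
  assumes x: "x \<in> gen_dom T" and \<tau>: "0 < \<tau>"
    and b: "\<And>t. 0 < t \<Longrightarrow> t \<le> \<tau> \<Longrightarrow> norm (output_integral T C \<omega> t (2 * t) x) \<le> b * sqrt t"
    and b0: "0 \<le> b"
  shows "norm (output_integral T C \<omega> 0 \<tau> x) \<le> 3 * b * sqrt \<tau>"
proof -
  let ?F = "\<lambda>t. output_integral T C \<omega> 0 t x"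
  have int: "(\<lambda>t. exp (\<i> * of_real (\<omega> * t)) *\<^sub>C C (T t x)) integrable_on {0..t}" for t
    by (intro integrable_continuous_real continuous_on_subset[OF continuous_frequency[OF x]]) auto
  have halve: "norm (?F t) \<le> norm (?F (t / 2)) + 3 * b * (sqrt t - sqrt (t / 2))"
    if t: "0 < t" "t \<le> \<tau>" for t
  proof -
    have "?F t = ?F (t / 2) + output_integral T C \<omega> (t / 2) (2 * (t / 2)) x"
      unfolding output_integral_def using t int
      by (subst Henstock_Kurzweil_Integration.integral_combine) auto
    also have "norm \<dots> \<le> norm (?F (t / 2)) + b * sqrt (t / 2)"
      using t by (intro order_trans[OF norm_triangle_ineq] add_mono b) auto
    finally have le: "norm (?F t) \<le> norm (?F (t / 2)) + b * sqrt (t / 2)" .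
    \<comment> \<open>as \<open>sqrt (1/2) \<le> 3/4\<close>, the increment \<open>b sqrt (t/2)\<close> telescopes with factor \<open>3\<close>\<close>
    have "sqrt (t / 2) \<le> sqrt ((3 / 4)\<^sup>2 * t)"
      using t by (intro real_sqrt_le_mono) (simp add: power2_eq_square)
    then have "sqrt (t / 2) \<le> 3 / 4 * sqrt t"
      by (simp add: real_sqrt_mult)
    then have "b * sqrt (t / 2) \<le> b * (3 * (sqrt t - sqrt (t / 2)))"
      by (intro mult_left_mono b0) simp
    with le show ?thesis by (simp add: algebra_simps)
  qed
  have iter: "norm (?F \<tau>) \<le> norm (?F (\<tau> / 2 ^ n)) + 3 * b * (sqrt \<tau> - sqrt (\<tau> / 2 ^ n))" for n
  proof (induction n)
    case (Suc n)
    have "norm (?F (\<tau> / 2 ^ n)) \<le> norm (?F (\<tau> / 2 ^ n / 2))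
        + 3 * b * (sqrt (\<tau> / 2 ^ n) - sqrt (\<tau> / 2 ^ n / 2))"
      using \<tau> by (intro halve) (auto simp: divide_le_eq mult_le_cancel_left1)
    moreover have "\<tau> / 2 ^ n / 2 = \<tau> / 2 ^ Suc n" by simp
    ultimately have "norm (?F (\<tau> / 2 ^ n)) \<le> norm (?F (\<tau> / 2 ^ Suc n))
        + 3 * b * (sqrt (\<tau> / 2 ^ n) - sqrt (\<tau> / 2 ^ Suc n))"
      by (simp only:)
    with Suc show ?case unfolding right_diff_distrib by linarith
  qed simp
  have "(\<lambda>n. \<tau> * (1 / 2) ^ n) \<longlonglongrightarrow> \<tau> * 0"
    by (intro tendsto_mult tendsto_const LIMSEQ_realpow_zero) auto
  then have lim0: "(\<lambda>n. \<tau> / 2 ^ n) \<longlonglongrightarrow> 0"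
    by (simp add: power_one_over)
  have "continuous_on {0..\<tau>} ?F"
    unfolding output_integral_def by (rule indefinite_integral_continuous_1[OF int])
  then have "(\<lambda>n. ?F (\<tau> / 2 ^ n)) \<longlonglongrightarrow> ?F 0"
  proof (rule continuous_on_tendsto_compose[OF _ lim0])
    show "\<forall>\<^sub>F n in sequentially. \<tau> / 2 ^ n \<in> {0..\<tau>}"
      using \<tau> by (intro always_eventually) (simp add: divide_le_eq mult_le_cancel_left1)
  qed (use \<tau> in simp)
  then have "(\<lambda>n. norm (?F (\<tau> / 2 ^ n)) + 3 * b * (sqrt \<tau> - sqrt (\<tau> / 2 ^ n)))
      \<longlonglongrightarrow> norm (?F 0) + 3 * b * (sqrt \<tau> - sqrt 0)"
    by (intro tendsto_intros lim0)
  then have "norm (?F \<tau>) \<le> norm (?F 0) + 3 * b * (sqrt \<tau> - sqrt 0)"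
    by (rule LIMSEQ_le_const) (use iter in blast)
  then show ?thesis by (simp add: output_integral_def)
qed

end

section \<open>Equivalence of the conditions\<close>

text \<open>The requirements on the constants \<open>K\<^sub>\<tau>\<close> in (B2a) and (B2b).\<close>

definition vanishing_rate :: "(real \<Rightarrow> real) \<Rightarrow> bool"
  where "vanishing_rate K \<longleftrightarrow>
    (\<forall>\<tau>>0. K \<tau> > 0) \<and> bounded (K ` {0<..}) \<and> (K \<longlongrightarrow> 0) (at_right 0)"

lemma vanishing_rate_pos: "vanishing_rate K \<Longrightarrow> 0 < \<tau> \<Longrightarrow> 0 < K \<tau>"
  by (simp add: vanishing_rate_def)

lemma bounded_image_cmult:
  fixes f :: "'a \<Rightarrow> real"
  shows "bounded (f ` S) \<Longrightarrow> bounded ((\<lambda>x. c * f x) ` S)"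
  using bounded_scaling[of "f ` S" c] by (simp add: image_image)

lemma vanishing_rate_cmult:
  "vanishing_rate K \<Longrightarrow> 0 < c \<Longrightarrow> vanishing_rate (\<lambda>\<tau>. c * K \<tau>)"
  unfolding vanishing_rate_def by (intro conjI bounded_image_cmult tendsto_mult_right_zero) auto

text \<open>The running supremum of a vanishing rate dominates all earlier values.\<close>

lemma vanishing_rate_majorant:
  assumes "vanishing_rate K"
  shows "\<exists>L. vanishing_rate L \<and> (\<forall>t \<tau>. 0 < t \<longrightarrow> t \<le> \<tau> \<longrightarrow> K t \<le> L \<tau>)"
proof -
  have pos: "\<And>\<tau>. 0 < \<tau> \<Longrightarrow> 0 < K \<tau>" and lim: "(K \<longlongrightarrow> 0) (at_right 0)"
    using assms by (auto simp: vanishing_rate_def)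
  obtain B where "\<forall>y\<in>K ` {0<..}. norm y \<le> B"
    using assms unfolding vanishing_rate_def bounded_iff by blast
  then have B: "K \<tau> \<le> B" if "0 < \<tau>" for \<tau>
    using that by (simp add: abs_le_iff)
  define L where "L \<tau> = Sup (K ` {0<..\<tau>})" for \<tau>
  have le: "K t \<le> L \<tau>" if "0 < t" "t \<le> \<tau>" for t \<tau>
    unfolding L_def
  proof (rule cSup_upper)
    show "bdd_above (K ` {0<..\<tau>})"
      by (rule bdd_aboveI2[where M = B]) (simp add: B)
  qed (use that in simp)
  have L_le: "L \<tau> \<le> b" if "0 < \<tau>" "\<And>t. 0 < t \<Longrightarrow> t \<le> \<tau> \<Longrightarrow> K t \<le> b" for \<tau> b
    unfolding L_def by (rule cSup_least) (use that in auto)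
  have L_pos: "0 < L \<tau>" if "0 < \<tau>" for \<tau>
    using le[of \<tau> \<tau>] pos[of \<tau>] that by simp
  have "bounded (L ` {0<..})"
    unfolding bounded_iff
  proof (intro exI[of _ B] ballI)
    fix y assume "y \<in> L ` {0<..}"
    then obtain \<tau> where "0 < \<tau>" "y = L \<tau>" by auto
    then show "norm y \<le> B" using L_pos[of \<tau>] L_le[of \<tau> B] B by simp
  qed
  moreover have "(L \<longlongrightarrow> 0) (at_right 0)"
  proof (rule tendstoI)
    fix e :: real assume e: "0 < e"
    then have "\<forall>\<^sub>F t in at_right 0. dist (K t) 0 < e / 2"
      using lim by (intro tendstoD) auto
    then obtain d where d: "0 < d" "\<And>t. 0 < t \<Longrightarrow> t < d \<Longrightarrow> \<bar>K t\<bar> < e / 2"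
      by (auto simp: eventually_at_right[of 0 1, simplified])
    have "dist (L \<tau>) 0 < e" if \<tau>: "0 < \<tau>" "\<tau> < d" for \<tau>
    proof -
      have "L \<tau> \<le> e / 2"
      proof (rule L_le[OF \<tau>(1)])
        show "K t \<le> e / 2" if "0 < t" "t \<le> \<tau>" for t
          using d(2)[of t] \<tau>(2) that by linarith
      qed
      then show ?thesis using L_pos[OF \<tau>(1)] e by simp
    qed
    then show "\<forall>\<^sub>F \<tau> in at_right 0. dist (L \<tau>) 0 < e"
      using d(1) by (auto simp: eventually_at_right[of 0 1, simplified])
  qed
  ultimately have "vanishing_rate L"
    by (simp add: vanishing_rate_def L_pos)
  with le show ?thesis by blast
qed

lemma norm_powr_minus_half:
  fixes y :: "'a::real_normed_vector"
  assumes "0 < \<tau>"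
  shows "norm (\<tau> powr (- 1 / 2) *\<^sub>R y) \<le> k \<longleftrightarrow> norm y \<le> k * sqrt \<tau>"
proof -
  have "\<tau> powr (- 1 / 2) = 1 / sqrt \<tau>"
    using assms powr_minus_divide[of \<tau> "1 / 2"] by (simp add: powr_half_sqrt)
  then show ?thesis using assms by (simp add: divide_le_eq)
qed

lemma cond_B2a_iff:
  "cond_B2a T C \<longleftrightarrow> (\<exists>K. vanishing_rate K \<and> (\<forall>\<tau>>0. \<forall>x\<in>gen_dom T. \<forall>\<omega>.
    norm (output_integral T C \<omega> 0 \<tau> x) \<le> K \<tau> * norm x * sqrt \<tau>))"
  unfolding cond_B2a_def vanishing_rate_def output_integral_def conj_assoc
  by (simp only: norm_powr_minus_half cong: imp_cong)

lemma cond_B2b_iff: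
  "cond_B2b T C \<longleftrightarrow> (\<exists>K. vanishing_rate K \<and> (\<forall>\<tau>>0. \<forall>x\<in>gen_dom T. \<forall>\<omega>.
    norm (output_integral T C \<omega> \<tau> (2 * \<tau>) x) \<le> K \<tau> * norm x * sqrt \<tau>))"
  unfolding cond_B2b_def vanishing_rate_def output_integral_def conj_assoc
  by (simp only: norm_powr_minus_half cong: imp_cong)

context observed_semigroup
begin

lemma B1_imp_B2a:
  assumes "cond_B1 T C"
  shows "cond_B2a T C"
proof -
  obtain m where m: "\<And>r. 0 < r \<Longrightarrow> 0 < m r" "bounded (m ` {0<..})" "(m \<longlongrightarrow> 0) at_top"
    and le: "\<And>x s. 0 < Re s \<Longrightarrow> norm (C (resolvent T s x)) \<le> m (Re s) * norm x / sqrt (Re s)"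
    using assms unfolding cond_B1_def by blast
  have "bounded ((\<lambda>\<tau>. m (inverse \<tau>)) ` {0<..})"
    by (rule bounded_subset[OF m(2)]) auto
  moreover have "((\<lambda>\<tau>. m (inverse \<tau>)) \<longlongrightarrow> 0) (at_right 0)"
    by (rule filterlim_compose[OF m(3) filterlim_inverse_at_top_right])
  ultimately have "vanishing_rate (\<lambda>\<tau>. (2 * M + 1) * m (inverse \<tau>))"
    using m(1) M_ge_1 by (intro vanishing_rate_cmult) (auto simp: vanishing_rate_def)
  moreover have "norm (output_integral T C \<omega> 0 \<tau> x) \<le> (2 * M + 1) * m (inverse \<tau>) * norm x * sqrt \<tau>"
    if \<tau>: "0 < \<tau>" and x: "x \<in> gen_dom T" for \<tau> x \<omega>
  proof -
    have "norm (C (resolvent T (Complex (1 / \<tau>) (- \<omega>)) z)) \<le> (m (inverse \<tau>) * sqrt \<tau>) * norm z" for z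
      using le[of "Complex (1 / \<tau>) (- \<omega>)" z] \<tau>
      by (simp add: inverse_eq_divide real_sqrt_divide mult_ac)
    from output_integral_le_resolvent[OF \<tau> x refl this] show ?thesis
      using m(1)[of "inverse \<tau>"] \<tau> by (simp add: abs_mult mult_ac)
  qed
  ultimately show ?thesis
    unfolding cond_B2a_iff by (intro exI conjI) auto
qed

lemma B2a_imp_B1:
  assumes "cond_B2a T C"
  shows "cond_B1 T C"
proof -
  obtain K where K: "vanishing_rate K"
    and le: "\<And>\<tau> x \<omega>. 0 < \<tau> \<Longrightarrow> x \<in> gen_dom T \<Longrightarrow>
      norm (output_integral T C \<omega> 0 \<tau> x) \<le> K \<tau> * norm x * sqrt \<tau>"
    using assms unfolding cond_B2a_iff by blast
  obtain L where L: "vanishing_rate L" and KL: "\<And>t \<tau>. 0 < t \<Longrightarrow> t \<le> \<tau> \<Longrightarrow> K t \<le> L \<tau>"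
    using vanishing_rate_majorant[OF K] by blast
  define c where "c = ln (2 * M)"
  have c: "0 < c" using M_ge_1 by (simp add: c_def)
  define d where "d = 2 * (1 + c) * sqrt c"
  have d: "0 < d" using c by (simp add: d_def)
  define m where "m r = d * L (c / r)" for r
  have "0 < m r" if "0 < r" for r
    using that c d vanishing_rate_pos[OF L] by (simp add: m_def)
  moreover have "bounded (m ` {0<..})"
    unfolding m_def
  proof (rule bounded_image_cmult)
    have "(\<lambda>r. L (c / r)) ` {0<..} \<subseteq> L ` {0<..}" using c by auto
    then show "bounded ((\<lambda>r. L (c / r)) ` {0<..})"
      using L by (meson bounded_subset vanishing_rate_def)
  qed
  moreover have "(m \<longlongrightarrow> 0) at_top"
    unfolding m_def
  proof (rule tendsto_mult_right_zero)
    have "((\<lambda>r. c / r) \<longlongrightarrow> 0) at_top"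
      by (rule real_tendsto_divide_at_top[OF tendsto_const filterlim_ident])
    then have "filterlim (\<lambda>r. c / r) (at_right 0) at_top"
      using c by (auto simp: filterlim_at intro!: eventually_mono[OF eventually_gt_at_top[of 0]])
    then show "((\<lambda>r. L (c / r)) \<longlongrightarrow> 0) at_top"
      using L by (auto simp: vanishing_rate_def intro: filterlim_compose)
  qed
  moreover have "norm (C (resolvent T s x)) \<le> m (Re s) * norm x / sqrt (Re s)" if s: "0 < Re s" for x s
  proof -
    let ?\<tau> = "c / Re s"
    have \<tau>: "0 < ?\<tau>" using c s by simp
    have L\<tau>: "0 < L ?\<tau>" by (rule vanishing_rate_pos[OF L \<tau>])
    have "norm (output_integral T C (- Im s) 0 t z) \<le> (L ?\<tau> * sqrt ?\<tau>) * norm z"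
      if t: "0 \<le> t" "t \<le> ?\<tau>" and z: "z \<in> gen_dom T" for t z
    proof (cases "t = 0")
      case False
      with t have t0: "0 < t" by simp
      have "K t * norm z * sqrt t \<le> L ?\<tau> * norm z * sqrt ?\<tau>"
        using t t0 L\<tau> by (intro mult_mono KL real_sqrt_le_mono mult_nonneg_nonneg) auto
      with le[OF t0 z, of "- Im s"] show ?thesis by (simp add: mult_ac)
    qed (use L\<tau> \<tau> in \<open>simp add: output_integral_def\<close>)
    then have "norm (C (resolvent T s x)) \<le> 2 * (1 + c) * (L ?\<tau> * sqrt ?\<tau>) * norm x"
      unfolding c_def using L\<tau> \<tau>
      by (intro resolvent_le_output_integral[OF s refl]) (auto simp: c_def)
    then show ?thesis
      by (simp add: m_def d_def real_sqrt_divide mult_ac)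
  qed
  ultimately show ?thesis
    unfolding cond_B1_def by (intro exI[of _ m] conjI allI impI)
qed

lemma B2a_imp_B2b:
  assumes "cond_B2a T C"
  shows "cond_B2b T C"
proof -
  obtain K where K: "vanishing_rate K"
    and le: "\<And>\<tau> x \<omega>. 0 < \<tau> \<Longrightarrow> x \<in> gen_dom T \<Longrightarrow>
      norm (output_integral T C \<omega> 0 \<tau> x) \<le> K \<tau> * norm x * sqrt \<tau>"
    using assms unfolding cond_B2a_iff by blast
  have "norm (output_integral T C \<omega> \<tau> (2 * \<tau>) x) \<le> M * K \<tau> * norm x * sqrt \<tau>"
    if \<tau>: "0 < \<tau>" and x: "x \<in> gen_dom T" for \<tau> x \<omega>
  proof -
    have Tx: "T \<tau> x \<in> gen_dom T"
      using has_gen_T[OF has_gen_gen[OF x]] has_gen_imp \<tau> by (meson less_imp_le)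
    have "norm (output_integral T C \<omega> \<tau> (2 * \<tau>) x) = norm (output_integral T C \<omega> 0 \<tau> (T \<tau> x))"
      using \<tau> x by (simp add: output_integral_shift norm_scaleC)
    also have "\<dots> \<le> K \<tau> * norm (T \<tau> x) * sqrt \<tau>"
      by (rule le[OF \<tau> Tx])
    also have "\<dots> \<le> K \<tau> * (M * norm x) * sqrt \<tau>"
      using \<tau> vanishing_rate_pos[OF K \<tau>] by (intro mult_right_mono mult_left_mono bound) auto
    finally show ?thesis by (simp add: mult_ac)
  qed
  moreover have "vanishing_rate (\<lambda>\<tau>. M * K \<tau>)"
    using M_ge_1 by (intro vanishing_rate_cmult K) simp
  ultimately show ?thesis
    unfolding cond_B2b_iff by (intro exI conjI) auto
qed

lemma B2b_imp_B2a:
  assumes "cond_B2b T C"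
  shows "cond_B2a T C"
proof -
  obtain K where K: "vanishing_rate K"
    and le: "\<And>\<tau> x \<omega>. 0 < \<tau> \<Longrightarrow> x \<in> gen_dom T \<Longrightarrow>
      norm (output_integral T C \<omega> \<tau> (2 * \<tau>) x) \<le> K \<tau> * norm x * sqrt \<tau>"
    using assms unfolding cond_B2b_iff by blast
  obtain L where L: "vanishing_rate L" and KL: "\<And>t \<tau>. 0 < t \<Longrightarrow> t \<le> \<tau> \<Longrightarrow> K t \<le> L \<tau>"
    using vanishing_rate_majorant[OF K] by blast
  have "norm (output_integral T C \<omega> 0 \<tau> x) \<le> 3 * L \<tau> * norm x * sqrt \<tau>"
    if \<tau>: "0 < \<tau>" and x: "x \<in> gen_dom T" for \<tau> x \<omega>
  proof -
    have "norm (output_integral T C \<omega> 0 \<tau> x) \<le> 3 * (L \<tau> * norm x) * sqrt \<tau>"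
    proof (rule output_integral_dyadic[OF x \<tau>])
      fix t assume t: "0 < t" "t \<le> \<tau>"
      have "K t * norm x * sqrt t \<le> L \<tau> * norm x * sqrt t"
        using t by (intro mult_right_mono KL) auto
      with le[OF t(1) x, of \<omega>]
      show "norm (output_integral T C \<omega> t (2 * t) x) \<le> L \<tau> * norm x * sqrt t" by linarith
    qed (use vanishing_rate_pos[OF L \<tau>] in simp)
    then show ?thesis by (simp add: mult_ac)
  qed
  moreover have "vanishing_rate (\<lambda>\<tau>. 3 * L \<tau>)"
    by (intro vanishing_rate_cmult L) simp
  ultimately show ?thesis
    unfolding cond_B2a_iff by (intro exI conjI) auto
qed

end

theorem theorem3p2:
  fixes T :: "real \<Rightarrow> 'h::complex_hilbert_space \<Rightarrow> 'h"
    and C :: "'h \<Rightarrow> 'y::complex_hilbert_space"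
  assumes "C0_semigroup T"
    and "bounded_semigroup T"
    and "infinite_time_admissible T C"
  shows "(cond_B1 T C \<longleftrightarrow> cond_B2a T C) \<and> (cond_B1 T C \<longleftrightarrow> cond_B2b T C)"
proof -
  obtain M where M: "\<And>t x. 0 \<le> t \<Longrightarrow> norm (T t x) \<le> M * norm x"
    using assms(2) unfolding bounded_semigroup_def by blast
  have "norm (T t x) \<le> max 1 M * norm x" if "0 \<le> t" for t x
    using M[OF that, of x] mult_right_mono[of M "max 1 M" "norm x"] by simp
  then interpret observed_semigroup T "max 1 M" C
    using assms by unfold_locales (auto simp: infinite_time_admissible_def)
  show ?thesis
    using B1_imp_B2a B2a_imp_B1 B2a_imp_B2b B2b_imp_B2a by blast
qed

end
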